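(* Let $\mathfrak{h}$ be a six-dimensional real Lie algebra and let $\omega_0$ be a closed 2-form on it. Assume that $\mathfrak{h}$ admits a definite 3-form $\rho$ and a symplectic form $\widetilde{\omega}$ such that (a) $\widetilde{\omega}$ is a taming form for the almost complex structure $J_\rho$ on $\mathfrak{h}$ induced by $\rho$ and one of the two orientations of $\mathfrak{h}$; (b) $d\rho=-\widetilde{\omega}\wedge\omega_0$. Then the seven-dimensional Lie algebra $\mathfrak{g}=\mathfrak{h}\oplus\mathbb{R}z$ obtained as the central extension of $(\mathfrak{h},\omega_0)$ is endowed with a closed $\mathrm{G}_2$-structure defined by the 3-form \[ \varphi=\widetilde{\omega}\wedge\theta+\rho . \]
   Context: $d$ denotes the Chevalley-Eilenberg differential, with $d\alpha(x,y)=-\alpha([x,y])$ for 1-forms $\alpha$. A symplectic form on a Lie algebra is a closed non-degenerate 2-form. A 3-form $\rho$ on a six-dimensional vector space $V$ is definite if $\iota_v\rho$ has rank four for each non-zero $v\in V$. Given an orientation $\Omega\in\Lambda^6V^*$, define $S_\rho\in\mathrm{End}(V)$ by $\iota_v\rho\wedge\rho\wedge\eta=\eta(S_\rho(v))\,\Omega$ for all $\eta\in V^*$; then $S_\rho^2=P(\rho)\mathrm{Id}_V$ with $P(\rho)<0$ when $\rho$ is definite, and the induced complex structure is $J_\rho=(-P(\rho))^{-1/2}S_\rho$. A 2-form $\widetilde\omega$ is taming for $J_\rho$ if $\widetilde\omega(v,J_\rho v)>0$ for every non-zero $v\in V$. A 3-form $\varphi$ on a seven-dimensional vector space $W$ is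 definite if $\iota_w\varphi$ has rank six for each non-zero $w\in W$. A $\mathrm{G}_2$-structure on a seven-dimensional Lie algebra is a definite 3-form $\varphi$ on it; it is closed if $d\varphi=0$. Central extension: for a Lie algebra $(\mathfrak{h},[\cdot,\cdot]_{\mathfrak{h}})$ and a closed $\omega_0\in\Lambda^2\mathfrak{h}^*$, it is $\mathfrak{g}=\mathfrak{h}\oplus\mathbb{R}z$ with bracket $[z,\mathfrak{h}]=0$, $[x,y]=-\omega_0(x,y)z+[x,y]_{\mathfrak{h}}$ for $x,y\in\mathfrak{h}$. The covector $\theta\in\mathfrak{g}^*$ is defined by $\theta(z)=1$, $\theta|_{\mathfrak{h}}=0$. Forms on $\mathfrak{h}$ are extended to $\mathfrak{g}$ so that their contraction with $z$ vanishes. *)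

theory Defs
  imports "HOL-Analysis.Analysis" "HOL-Library.Function_Algebras"
begin

section \<open>Exterior forms\<close>

text \<open>
  A form on a real vector space is evaluated on lists of vectors; a form of degree \<open>k\<close> is set to
  zero on lists whose length is not \<open>k\<close>, so that the degree need not be an argument of the
  operations below and equality of forms is equality of functions. Sums, negatives and zero of
  forms are the pointwise ones.
\<close>

type_synonym 'v form = "'v list \<Rightarrow> real"

definition is_form :: "nat \<Rightarrow> 'v::real_vector form \<Rightarrow> bool" where
  "is_form k \<alpha> \<longleftrightarrow>
     (\<forall>xs. length xs \<noteq> k \<longrightarrow> \<alpha> xs = 0) \<and>
     (\<forall>xs i. length xs = k \<and> i < k \<longrightarrow> linear (\<lambda>x. \<alpha> (xs[i := x]))) \<and>
     (\<forall>xs i j. length xs = k \<and> i < j \<and> j < k \<and> xs ! i = xs ! j \<longrightarrow> \<alpha> xs = 0)"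

text \<open>
  The wedge product is the sum over shuffles: \<open>A\<close> is the set of positions whose vectors are fed to
  \<open>\<alpha>\<close>, and the exponent counts the inversions of the permutation that lists \<open>A\<close> before its
  complement. There is no factorial factor, so for 1-forms
  \<open>(\<alpha> \<^bold>\<and> \<beta>)(x, y) = \<alpha>(x) \<beta>(y) - \<alpha>(y) \<beta>(x)\<close>.
\<close>

definition wedge :: "'v form \<Rightarrow> 'v form \<Rightarrow> 'v form" (infixl \<open>\<^bold>\<and>\<close> 70) where
  "(\<alpha> \<^bold>\<and> \<beta>) xs =
     (\<Sum>A\<in>Pow {..<length xs}.
        (- 1) ^ card {(i, j). i \<in> A \<and> j \<in> {..<length xs} - A \<and> j < i} *
        \<alpha> (nths xs A) * \<beta> (nths xs (- A)))"

definition contract :: "'v \<Rightarrow> 'v form \<Rightarrow> 'v form" where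
  "contract v \<alpha> xs = \<alpha> (v # xs)"

text \<open>
  The rank of a 2-form \<open>\<alpha>\<close> is the rank of the linear map \<open>x \<mapsto> \<alpha>(x, \<cdot>)\<close> into the dual space, i.e.
  the codimension of its kernel; it is used in finite dimension only.
\<close>

definition form_rank :: "'v::real_vector form \<Rightarrow> nat" where
  "form_rank \<alpha> = dim (UNIV :: 'v set) - dim {x. \<forall>y. \<alpha> [x, y] = 0}"


section \<open>Definite 3-forms in dimensions six and seven\<close>

definition definite6 :: "'v::real_vector form \<Rightarrow> bool" where
  "definite6 \<rho> \<longleftrightarrow> dim (UNIV :: 'v set) = 6 \<and> is_form 3 \<rho> \<and>
     (\<forall>v. v \<noteq> 0 \<longrightarrow> form_rank (contract v \<rho>) = 4)"

definition definite7 :: "'v::real_vector form \<Rightarrow> bool" where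
  "definite7 \<phi> \<longleftrightarrow> dim (UNIV :: 'v set) = 7 \<and> is_form 3 \<phi> \<and>
     (\<forall>w. w \<noteq> 0 \<longrightarrow> form_rank (contract w \<phi>) = 6)"

text \<open>
  An orientation is represented by a non-zero 6-form. \<open>S_endo\<close> depends on this form, but
  \<open>J_endo\<close> is unchanged when the form is multiplied by a positive number.
\<close>

definition orientation6 :: "'v::real_vector form \<Rightarrow> bool" where
  "orientation6 \<Omega> \<longleftrightarrow> dim (UNIV :: 'v set) = 6 \<and> is_form 6 \<Omega> \<and> \<Omega> \<noteq> 0"

definition S_endo :: "'v::real_vector form \<Rightarrow> 'v form \<Rightarrow> 'v \<Rightarrow> 'v" where
  "S_endo \<Omega> \<rho> = (THE S. linear S \<and>
     (\<forall>v \<eta>. is_form 1 \<eta> \<longrightarrow>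
        contract v \<rho> \<^bold>\<and> \<rho> \<^bold>\<and> \<eta> = (\<lambda>xs. \<eta> [S v] * \<Omega> xs)))"

definition P_scalar :: "'v::real_vector form \<Rightarrow> 'v form \<Rightarrow> real" where
  "P_scalar \<Omega> \<rho> = (THE p. \<forall>v. S_endo \<Omega> \<rho> (S_endo \<Omega> \<rho> v) = p *\<^sub>R v)"

definition J_endo :: "'v::real_vector form \<Rightarrow> 'v form \<Rightarrow> 'v \<Rightarrow> 'v" where
  "J_endo \<Omega> \<rho> v = (1 / sqrt (- P_scalar \<Omega> \<rho>)) *\<^sub>R S_endo \<Omega> \<rho> v"

definition taming :: "('v::real_vector \<Rightarrow> 'v) \<Rightarrow> 'v form \<Rightarrow> bool" where
  "taming J \<omega> \<longleftrightarrow> is_form 2 \<omega> \<and> (\<forall>v. v \<noteq> 0 \<longrightarrow> \<omega> [v, J v] > 0)"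


section \<open>Lie algebras\<close>

definition lie_algebra :: "('v::real_vector \<Rightarrow> 'v \<Rightarrow> 'v) \<Rightarrow> bool" where
  "lie_algebra br \<longleftrightarrow> bilinear br \<and> (\<forall>x. br x x = 0) \<and>
     (\<forall>x y z. br x (br y z) + br y (br z x) + br z (br x y) = 0)"

text \<open>
  The Chevalley-Eilenberg differential; positions are counted from 0, which does not affect the
  parity of \<open>i + j\<close>.
\<close>

definition ce_diff :: "('v \<Rightarrow> 'v \<Rightarrow> 'v) \<Rightarrow> 'v form \<Rightarrow> 'v form" where
  "ce_diff br \<alpha> xs =
     (\<Sum>j<length xs. \<Sum>i<j. (- 1) ^ (i + j) * \<alpha> (br (xs ! i) (xs ! j) # nths xs (- {i, j})))"

definition symplectic :: "('v::real_vector \<Rightarrow> 'v \<Rightarrow> 'v) \<Rightarrow> 'v form \<Rightarrow> bool" where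
  "symplectic br \<omega> \<longleftrightarrow> is_form 2 \<omega> \<and> ce_diff br \<omega> = 0 \<and>
     (\<forall>x. (\<forall>y. \<omega> [x, y] = 0) \<longrightarrow> x = 0)"

definition closed_G2_structure :: "('v::real_vector \<Rightarrow> 'v \<Rightarrow> 'v) \<Rightarrow> 'v form \<Rightarrow> bool" where
  "closed_G2_structure br \<phi> \<longleftrightarrow> definite7 \<phi> \<and> ce_diff br \<phi> = 0"


section \<open>Central extensions\<close>

text \<open>
  The space \<open>h \<oplus> \<real>z\<close> is the product type, with \<open>z = (0, 1)\<close>; \<open>theta\<close> is the covector with
  \<open>theta(z) = 1\<close> vanishing on the first factor.
\<close>

definition central_ext ::
  "('v::real_vector \<Rightarrow> 'v \<Rightarrow> 'v) \<Rightarrow> 'v form \<Rightarrow> 'v \<times> real \<Rightarrow> 'v \<times> real \<Rightarrow> 'v \<times> real" where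
  "central_ext br \<omega>\<^sub>0 u w = (br (fst u) (fst w), - \<omega>\<^sub>0 [fst u, fst w])"

definition theta :: "('v \<times> real) form" where
  "theta xs = (case xs of [u] \<Rightarrow> snd u | _ \<Rightarrow> 0)"

definition extend_form :: "'v form \<Rightarrow> ('v \<times> real) form" where
  "extend_form \<alpha> xs = \<alpha> (map fst xs)"

end

theory Submission imports Defs begin

text \<open>
  Write \<open>J\<close> for the complex structure induced by \<open>\<rho>\<close>. The kernel of \<open>\<iota>\<^sub>v \<rho>\<close> is two-dimensional and
  contains \<open>v\<close> and \<open>J v\<close>, which taming makes independent. Let \<open>(x, b)\<close> be in the kernel of
  \<open>\<iota>\<^sub>w \<phi>\<close> with \<open>w = (v, a)\<close> and \<open>v \<noteq> 0\<close>; then \<open>\<omega>(v, x) = 0\<close> and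
  \<open>\<rho>(v, x, y) = b \<omega>(v, y) - a \<omega>(x, y)\<close> for all \<open>y\<close>. If \<open>a = 0\<close>, then \<open>y = J v\<close> gives \<open>b = 0\<close>, so \<open>x\<close>
  is a combination of \<open>v\<close> and \<open>J v\<close>, and \<open>\<omega>(v, x) = 0\<close> leaves a multiple of \<open>v\<close>. If \<open>a \<noteq> 0\<close>,
  subtracting a multiple of \<open>w\<close> makes \<open>b = 0\<close>, and then \<open>y = J x\<close> gives \<open>\<omega>(x, J x) = 0\<close>, so \<open>x = 0\<close>.
  Closedness is \<open>d \<phi> = d \<omega> \<and> \<theta> + \<omega> \<and> \<omega>\<^sub>0 + d \<rho> = 0\<close>, since \<open>d \<theta> = \<omega>\<^sub>0\<close>.
\<close>

section \<open>Forms, contraction and the wedge product\<close>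

lemma is_form_length: "is_form k \<alpha> \<Longrightarrow> length xs \<noteq> k \<Longrightarrow> \<alpha> xs = 0"
  by (simp add: is_form_def)

lemma is_form_linear_Cons:
  assumes "is_form k \<alpha>"
  shows "linear (\<lambda>x. \<alpha> (x # xs))"
proof (cases "length (0 # xs) = k")
  case True
  then have "linear (\<lambda>x. \<alpha> ((0 # xs)[0 := x]))"
    using assms unfolding is_form_def by (metis length_greater_0_conv list.distinct(1))
  then show ?thesis by simp
next
  case False
  then have "(\<lambda>x. \<alpha> (x # xs)) = (\<lambda>_. 0)"
    using is_form_length[OF assms] by fastforce
  then show ?thesis by (simp add: linear_zero)
qed

lemma is_form_repeat:
  assumes "is_form k \<alpha>"
  shows "\<alpha> (x # ms @ x # zs) = 0"
proof (cases "length (x # ms @ x # zs) = k")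
  case True
  have "(x # ms @ x # zs) ! 0 = (x # ms @ x # zs) ! Suc (length ms)"
    by (simp add: nth_append)
  with True assms show ?thesis
    unfolding is_form_def
    by (metis add_Suc_right length_Cons length_append less_add_Suc1 zero_less_Suc Suc_less_eq)
qed (rule is_form_length[OF assms])

text \<open>Polarisation: expanding the zero value at the pair \<open>(x + y, x + y)\<close> leaves
  only the two mixed terms. If the length of the list does not fit the degree, both sides
  vanish.\<close>

lemma is_form_swap:
  assumes "is_form k \<alpha>"
  shows "\<alpha> (y # x # zs) = - \<alpha> (x # y # zs)"
proof (cases "length zs + 2 = k")
  case True
  have L: "linear (\<lambda>x. \<alpha> (x # y # zs))" for y
    by (rule is_form_linear_Cons[OF assms])
  have "linear (\<lambda>y. \<alpha> ((x # 0 # zs)[1 := y]))" for x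
    using assms True unfolding is_form_def
    by (metis One_nat_def Suc_1 add_2_eq_Suc' length_Cons less_Suc_eq_0_disj less_add_Suc2 add.commute)
  then have R: "linear (\<lambda>y. \<alpha> (x # y # zs))" for x by simp
  have Z: "\<alpha> (x # x # zs) = 0" for x
    using is_form_repeat[OF assms, of x "[]" zs] by simp
  show ?thesis
    using Z[of "x + y"] Z[of x] Z[of y] linear_add[OF L, of x y "x + y"]
      linear_add[OF R, of x x y] linear_add[OF R, of y x y]
    by simp
next
  case False
  then show ?thesis
    by (simp add: is_form_length[OF assms])
qed

text \<open>This is what makes induction on the degree possible. Alternation has to be known only
  for the first two arguments: swapping the head \<open>x\<close> with its neighbour
  \<open>m\<close> puts both copies of \<open>x\<close> inside \<open>contract m \<alpha>\<close>,
  which is alternating already.\<close>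

lemma is_form_SucI:
  assumes nil: "\<alpha> [] = 0"
    and ctr: "\<And>x. is_form k (contract x \<alpha>)"
    and lin: "\<And>xs. linear (\<lambda>x. \<alpha> (x # xs))"
    and alt: "\<And>x xs. \<alpha> (x # x # xs) = 0"
  shows "is_form (Suc k) \<alpha>"
proof -
  have c: "\<alpha> (x # xs) = contract x \<alpha> xs" for x xs by (simp add: contract_def)
  have swap: "\<alpha> (y # x # zs) = - \<alpha> (x # y # zs)" for x y zs
  proof -
    have L: "linear (\<lambda>x. \<alpha> (x # y # zs))" for y by (rule lin)
    have R: "linear (\<lambda>y. \<alpha> (x # y # zs))" for x
      using is_form_linear_Cons[OF ctr] by (simp add: c)
    show ?thesis
      using alt[of "x + y" zs] alt[of x zs] alt[of y zs] linear_add[OF L, of x y "x + y"]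
        linear_add[OF R, of x x y] linear_add[OF R, of y x y]
      by simp
  qed
  have rep: "\<alpha> (x # ms @ x # zs) = 0" for x ms zs
  proof (cases ms)
    case (Cons m ms')
    have "\<alpha> (x # ms @ x # zs) = - \<alpha> (m # x # ms' @ x # zs)"
      using swap[of x m "ms' @ x # zs"] Cons by simp
    then show ?thesis
      using is_form_repeat[OF ctr, of m x ms' zs] by (simp add: contract_def)
  qed (simp add: alt)
  show ?thesis
    unfolding is_form_def
  proof (intro conjI allI impI)
    fix xs :: "'a list" assume "length xs \<noteq> Suc k"
    then show "\<alpha> xs = 0"
      using nil is_form_length[OF ctr] by (cases xs) (auto simp: c)
  next
    fix xs :: "'a list" and i assume A: "length xs = Suc k \<and> i < Suc k"
    then obtain x ys where xs: "xs = x # ys" by (cases xs) auto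
    show "linear (\<lambda>x. \<alpha> (xs[i := x]))"
    proof (cases i)
      case 0
      then show ?thesis using lin by (simp add: xs)
    next
      case (Suc i')
      have "linear (\<lambda>y. contract x \<alpha> (ys[i' := y]))"
        using A ctr[of x] unfolding is_form_def by (simp add: xs Suc)
      then show ?thesis by (simp add: xs Suc contract_def)
    qed
  next
    fix xs :: "'a list" and i j
    assume A: "length xs = Suc k \<and> i < j \<and> j < Suc k \<and> xs ! i = xs ! j"
    then obtain x ys where xs: "xs = x # ys" by (cases xs) auto
    from A obtain j' where j: "j = Suc j'" by (cases j) auto
    show "\<alpha> xs = 0"
    proof (cases i)
      case 0
      then have "ys = take j' ys @ x # drop (Suc j') ys"
        using A xs j by (simp add: id_take_nth_drop)
      then show ?thesis using rep xs by metis
    next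
      case (Suc i')
      then have "length ys = k \<and> i' < j' \<and> j' < k \<and> ys ! i' = ys ! j'"
        using A by (simp add: xs j)
      then show ?thesis
        using ctr[of x] unfolding is_form_def xs c by blast
    qed
  qed
qed

lemma is_form_0: "is_form 0 \<alpha> \<longleftrightarrow> (\<forall>xs. xs \<noteq> [] \<longrightarrow> \<alpha> xs = 0)"
  by (auto simp: is_form_def)

lemma is_form_zero: "is_form k 0"
  by (auto simp: is_form_def linear_zero)

lemma is_form_add: "is_form k \<alpha> \<Longrightarrow> is_form k \<beta> \<Longrightarrow> is_form k (\<alpha> + \<beta>)"
  by (auto simp: is_form_def linear_compose_add)

lemma is_form_scale: "is_form k \<alpha> \<Longrightarrow> is_form k (\<lambda>xs. c * \<alpha> xs)"
  using linear_compose_scale_right[where c=c and 'b=real] by (fastforce simp: is_form_def)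

lemma contract_0form: "is_form 0 \<alpha> \<Longrightarrow> contract x \<alpha> = 0"
  by (auto simp: is_form_0 contract_def)

text \<open>The truncated subtraction is harmless: a 0-form has contraction zero, and the zero form
  has every degree.\<close>

lemma is_form_contract:
  assumes "is_form k \<alpha>"
  shows "is_form (k - 1) (contract x \<alpha>)"
proof (cases k)
  case 0
  then show ?thesis using assms by (simp add: contract_0form is_form_zero)
next
  case (Suc l)
  show ?thesis
    unfolding is_form_def
  proof (intro conjI allI impI)
    fix xs :: "'a list" assume "length xs \<noteq> k - 1"
    then show "contract x \<alpha> xs = 0"
      using is_form_length[OF assms] Suc by (simp add: contract_def)
  next
    fix xs :: "'a list" and i assume A: "length xs = k - 1 \<and> i < k - 1"
    then have "length (x # xs) = k \<and> Suc i < k" using Suc by auto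
    then have "linear (\<lambda>y. \<alpha> ((x # xs)[Suc i := y]))"
      using assms unfolding is_form_def by blast
    then show "linear (\<lambda>y. contract x \<alpha> (xs[i := y]))"
      by (simp add: contract_def)
  next
    fix xs :: "'a list" and i j
    assume A: "length xs = k - 1 \<and> i < j \<and> j < k - 1 \<and> xs ! i = xs ! j"
    then have "length (x # xs) = k \<and> Suc i < Suc j \<and> Suc j < k \<and> (x # xs) ! Suc i = (x # xs) ! Suc j"
      using Suc by auto
    then show "contract x \<alpha> xs = 0"
      using assms unfolding is_form_def contract_def by blast
  qed
qed

lemma contract_add: "is_form k \<alpha> \<Longrightarrow> contract (x + y) \<alpha> = contract x \<alpha> + contract y \<alpha>"
  by (auto simp: contract_def linear_add[OF is_form_linear_Cons])

lemma contract_scale: "is_form k \<alpha> \<Longrightarrow> contract (c *\<^sub>R x) \<alpha> = (\<lambda>xs. c * contract x \<alpha> xs)"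
  by (auto simp: contract_def linear_scale[OF is_form_linear_Cons])

lemma contract_contract: "is_form k \<alpha> \<Longrightarrow> contract x (contract x \<alpha>) = 0"
  using is_form_repeat[of k \<alpha> x "[]"] by (auto simp: contract_def)

lemma wedge_add_left: "((\<alpha> + \<alpha>') \<^bold>\<and> \<beta>) xs = (\<alpha> \<^bold>\<and> \<beta>) xs + (\<alpha>' \<^bold>\<and> \<beta>) xs"
  by (simp add: wedge_def algebra_simps sum.distrib)

lemma wedge_add_right: "(\<alpha> \<^bold>\<and> (\<beta> + \<beta>')) xs = (\<alpha> \<^bold>\<and> \<beta>) xs + (\<alpha> \<^bold>\<and> \<beta>') xs"
  by (simp add: wedge_def algebra_simps sum.distrib)

lemma wedge_scale_left: "((\<lambda>xs. c * \<alpha> xs) \<^bold>\<and> \<beta>) xs = c * (\<alpha> \<^bold>\<and> \<beta>) xs"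
  by (simp add: wedge_def sum_distrib_left mult_ac)

lemma wedge_scale_right: "(\<alpha> \<^bold>\<and> (\<lambda>xs. c * \<beta> xs)) xs = c * (\<alpha> \<^bold>\<and> \<beta>) xs"
  by (simp add: wedge_def sum_distrib_left mult_ac)

lemma wedge_zero_left: "(0 \<^bold>\<and> \<beta>) = 0"
  by (auto simp: wedge_def)

lemma wedge_zero_right: "(\<alpha> \<^bold>\<and> 0) = 0"
  by (auto simp: wedge_def)

lemma wedge_Nil: "(\<alpha> \<^bold>\<and> \<beta>) [] = \<alpha> [] * \<beta> []"
  by (simp add: wedge_def)

text \<open>Contraction with a vector is an antiderivation; the two summands collect the shuffles that
  feed the first position to \<open>\<alpha>\<close> and to \<open>\<beta>\<close>.\<close>

lemma wedge_Cons:
  assumes "is_form p \<alpha>"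
  shows "(\<alpha> \<^bold>\<and> \<beta>) (x # xs) =
    (contract x \<alpha> \<^bold>\<and> \<beta>) xs + (- 1) ^ p * (\<alpha> \<^bold>\<and> contract x \<beta>) xs"
proof -
  define n where "n = length xs"
  define inv where "inv = (\<lambda>m A. {(i, j). i \<in> A \<and> j \<in> {..<m} - A \<and> j < (i::nat)})"
  define g where "g = (\<lambda>A. (- 1) ^ card (inv (Suc n) A) * \<alpha> (nths (x # xs) A) * \<beta> (nths (x # xs) (- A)))"
  have fin: "finite (inv n A)" if "A \<subseteq> {..<n}" for A
    by (rule finite_subset[of _ "{..<n} \<times> {..<n}"]) (use that in \<open>auto simp: inv_def\<close>)
  have inj: "inj_on (\<lambda>A. Suc ` A) X" "inj_on (\<lambda>A. insert 0 (Suc ` A)) X" for X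
    by (auto simp: inj_on_def insert_ident inj_image_eq_iff)
  \<comment> \<open>The sets of positions are split by whether they contain \<open>0\<close>; what
    remains is a shifted set of positions of \<open>xs\<close>.\<close>
  have Pow: "Pow {..<Suc n} = (\<lambda>A. insert 0 (Suc ` A)) ` Pow {..<n} \<union> (\<lambda>A. Suc ` A) ` Pow {..<n}"
    unfolding lessThan_Suc_eq_insert_0 Pow_insert image_Pow_surj[OF refl, symmetric] image_image
    by (simp add: Un_commute)
  \<comment> \<open>Putting \<open>0\<close> into the set creates no inversion, since an inversion
    pairs a member with a smaller non-member.\<close>
  have img: "inv (Suc n) (insert 0 (Suc ` A)) = (\<lambda>(i, j). (Suc i, Suc j)) ` inv n A" for A
    by (auto simp: inv_def image_iff less_Suc_eq_0_disj)
  have c1: "card (inv (Suc n) (insert 0 (Suc ` A))) = card (inv n A)" for A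
    unfolding img by (rule card_image) (auto simp: inj_on_def)
  \<comment> \<open>With \<open>0\<close> outside the set, every member forms a new inversion with
    \<open>0\<close>; this is the extra summand \<open>card A\<close> below.\<close>
  have img2: "inv (Suc n) (Suc ` A) = (\<lambda>(i, j). (Suc i, Suc j)) ` inv n A \<union> (\<lambda>i. (Suc i, 0)) ` A" for A
    by (auto simp: inv_def image_iff less_Suc_eq_0_disj)
  have c2: "card (inv (Suc n) (Suc ` A)) = card (inv n A) + card A" if "A \<subseteq> {..<n}" for A
  proof -
    have "finite A" using that finite_subset by blast
    then have "card (inv (Suc n) (Suc ` A)) =
        card ((\<lambda>(i, j). (Suc i, Suc j)) ` inv n A) + card ((\<lambda>i. (Suc i, 0::nat)) ` A)"
      unfolding img2 by (intro card_Un_disjoint) (auto simp: fin[OF that])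
    also have "\<dots> = card (inv n A) + card A"
      by (intro arg_cong2[where f = "(+)"] card_image) (auto simp: inj_on_def)
    finally show ?thesis .
  qed
  have "(\<alpha> \<^bold>\<and> \<beta>) (x # xs) = sum g (Pow {..<Suc n})"
    by (simp add: wedge_def g_def inv_def n_def)
  also have "\<dots> = sum g ((\<lambda>A. insert 0 (Suc ` A)) ` Pow {..<n}) + sum g ((\<lambda>A. Suc ` A) ` Pow {..<n})"
    unfolding Pow by (rule sum.union_disjoint) auto
  also have "\<dots> = (\<Sum>A\<in>Pow {..<n}. g (insert 0 (Suc ` A))) + (\<Sum>A\<in>Pow {..<n}. g (Suc ` A))"
    by (simp add: sum.reindex inj)
  also have "(\<Sum>A\<in>Pow {..<n}. g (insert 0 (Suc ` A))) = (contract x \<alpha> \<^bold>\<and> \<beta>) xs"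
    unfolding wedge_def n_def[symmetric] inv_def[symmetric]
  proof (rule sum.cong)
    fix A
    have "{j. Suc j \<in> insert 0 (Suc ` A)} = A" "{j. Suc j \<in> - insert 0 (Suc ` A)} = - A" by auto
    then show "g (insert 0 (Suc ` A)) =
        (- 1) ^ card {(i, j). i \<in> A \<and> j \<in> {..<n} - A \<and> j < i} * contract x \<alpha> (nths xs A) * \<beta> (nths xs (- A))"
      unfolding g_def c1 by (simp add: nths_Cons contract_def inv_def)
  qed simp
  also have "(\<Sum>A\<in>Pow {..<n}. g (Suc ` A)) = (- 1) ^ p * (\<alpha> \<^bold>\<and> contract x \<beta>) xs"
    unfolding wedge_def n_def[symmetric] sum_distrib_left
  proof (rule sum.cong)
    fix A assume "A \<in> Pow {..<n}"
    then have A: "A \<subseteq> {..<n}" by simp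
    then have "{i. i < n \<and> i \<in> A} = A" by auto
    then have "length (nths xs A) = card A" by (simp add: length_nths n_def)
    \<comment> \<open>The new sign is \<open>(- 1) ^ card A\<close>. It may be replaced by
      \<open>(- 1) ^ p\<close>, because for every other cardinality the term vanishes by
      degree.\<close>
    then have z: "card A \<noteq> p \<Longrightarrow> \<alpha> (nths xs A) = 0"
      using is_form_length[OF assms] by simp
    have "{j. Suc j \<in> Suc ` A} = A" "{j. Suc j \<in> - Suc ` A} = - A" by auto
    then show "g (Suc ` A) = (- 1) ^ p * ((- 1) ^ card {(i, j). i \<in> A \<and> j \<in> {..<n} - A \<and> j < i} *
        \<alpha> (nths xs A) * contract x \<beta> (nths xs (- A)))"
      unfolding g_def c2[OF A] using z
      by (cases "card A = p") (auto simp: nths_Cons contract_def inv_def power_add)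
  qed simp
  finally show ?thesis .
qed

text \<open>The contraction of a 0-form is zero, so in the induction along the list only the term
  that feeds every vector to \<open>\<alpha>\<close> survives.\<close>

lemma wedge_0form_right:
  assumes "is_form p \<alpha>" "is_form 0 \<beta>"
  shows "(\<alpha> \<^bold>\<and> \<beta>) xs = \<alpha> xs * \<beta> []"
  using assms(1)
proof (induction xs arbitrary: \<alpha> p)
  case (Cons x xs)
  show ?case
    using Cons.IH[OF is_form_contract[OF Cons.prems, of x]]
    by (simp add: wedge_Cons[OF Cons.prems] contract_0form[OF assms(2)] wedge_zero_right contract_def[of x \<alpha> xs])
qed (simp add: wedge_Nil)

lemma contract_wedge:
  assumes "is_form p \<alpha>"
  shows "contract x (\<alpha> \<^bold>\<and> \<beta>) = (contract x \<alpha> \<^bold>\<and> \<beta>) + (\<lambda>xs. (- 1) ^ p * (\<alpha> \<^bold>\<and> contract x \<beta>) xs)"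
  by (rule ext) (simp add: contract_def[of x "\<alpha> \<^bold>\<and> \<beta>"] wedge_Cons[OF assms])

text \<open>Induction on the total degree: by \<open>contract_wedge\<close> a contraction of the
  product is a combination of two products of total degree one less, so \<open>is_form_SucI\<close>
  applies.\<close>

lemma is_form_wedge:
  assumes "is_form p \<alpha>" "is_form q \<beta>"
  shows "is_form (p + q) (\<alpha> \<^bold>\<and> \<beta>)"
  using assms
proof (induction "p + q" arbitrary: p q \<alpha> \<beta>)
  case 0
  then have "is_form 0 \<alpha>" "is_form 0 \<beta>" by auto
  then show ?case
    using wedge_0form_right[of 0 \<alpha> \<beta>] 0(1) by (simp add: is_form_0)
next
  case (Suc k)
  have l: "is_form k (contract x \<alpha> \<^bold>\<and> \<beta>)" for x
  proof (cases p)
    case 0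
    then show ?thesis using Suc.prems by (simp add: contract_0form wedge_zero_left is_form_zero)
  next
    case (Suc p')
    then show ?thesis
      using Suc.hyps(1)[of p' q] Suc.hyps(2) Suc.prems is_form_contract[of p \<alpha> x] by simp
  qed
  have r: "is_form k (\<alpha> \<^bold>\<and> contract x \<beta>)" for x
  proof (cases q)
    case 0
    then show ?thesis using Suc.prems by (simp add: contract_0form wedge_zero_right is_form_zero)
  next
    case (Suc q')
    then show ?thesis
      using Suc.hyps(1)[of p q'] Suc.hyps(2) Suc.prems is_form_contract[of q \<beta> x] by simp
  qed
  have "is_form (Suc k) (\<alpha> \<^bold>\<and> \<beta>)"
  proof (rule is_form_SucI)
    show "(\<alpha> \<^bold>\<and> \<beta>) [] = 0"
    proof (cases p)
      case 0
      then show ?thesis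
        using is_form_length[OF Suc.prems(2), of "[]"] Suc.hyps(2) by (simp add: wedge_Nil)
    next
      case (Suc p')
      then show ?thesis
        using is_form_length[OF Suc.prems(1), of "[]"] by (simp add: wedge_Nil)
    qed
    show "is_form k (contract x (\<alpha> \<^bold>\<and> \<beta>))" for x
      unfolding contract_wedge[OF Suc.prems(1)] by (intro is_form_add is_form_scale l r)
    show "linear (\<lambda>x. (\<alpha> \<^bold>\<and> \<beta>) (x # xs))" for xs
      by (rule linearI)
        (simp_all add: wedge_Cons[OF Suc.prems(1)] contract_add[OF Suc.prems(1)] contract_add[OF Suc.prems(2)]
          contract_scale[OF Suc.prems(1)] contract_scale[OF Suc.prems(2)]
          wedge_add_left wedge_add_right wedge_scale_left wedge_scale_right algebra_simps)
    \<comment> \<open>Contracting twice with \<open>x\<close> gives the product of the two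
      contractions twice, with signs \<open>(- 1) ^ p\<close> and \<open>(- 1) ^ (p - 1)\<close>,
      which cancel. The case \<open>p = 0\<close> stands apart because there \<open>p - 1\<close> is
      truncated.\<close>
    show "(\<alpha> \<^bold>\<and> \<beta>) (x # x # xs) = 0" for x xs
    proof (cases p)
      case 0
      then show ?thesis using Suc.prems
        by (simp add: wedge_Cons[OF Suc.prems(1)] contract_0form wedge_zero_left
            contract_contract[OF Suc.prems(2)] wedge_zero_right)
    next
      case (Suc p')
      then show ?thesis
        using wedge_Cons[OF is_form_contract[OF Suc.prems(1)]]
        by (simp add: wedge_Cons[OF Suc.prems(1)] contract_contract[OF Suc.prems(1)]
            contract_contract[OF Suc.prems(2)] wedge_zero_left wedge_zero_right)
    qed
  qed
  then show ?case using Suc.hyps(2) by simp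
qed

section \<open>Top-degree forms\<close>

text \<open>The vector \<open>x\<close> passes each element of \<open>as\<close> by one
  transposition.\<close>

lemma is_form_move:
  assumes "is_form k \<alpha>"
  shows "\<alpha> (as @ x # bs) = (- 1) ^ length as * \<alpha> (x # as @ bs)"
  using assms
proof (induction as arbitrary: k \<alpha>)
  case (Cons a as)
  have "\<alpha> (a # as @ x # bs) = (- 1) ^ length as * \<alpha> (a # x # as @ bs)"
    using Cons.IH[OF is_form_contract[OF Cons.prems, of a]] by (simp add: contract_def)
  also have "\<dots> = (- 1) ^ length (a # as) * \<alpha> (x # a # as @ bs)"
    by (simp add: is_form_swap[OF Cons.prems, of a x])
  finally show ?case by simp
qed simp

text \<open>Only vanishing is transported, so the sign of the permutation is never computed: the
  head of \<open>xs\<close> is moved to the front of \<open>ys\<close>, and the induction continues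
  with the contraction.\<close>

lemma is_form_perm:
  assumes "is_form k \<alpha>" "mset xs = mset ys" "\<alpha> xs = 0"
  shows "\<alpha> ys = 0"
  using assms
proof (induction xs arbitrary: ys k \<alpha>)
  case (Cons x xs)
  then have "x \<in> set ys" by (metis list.set_intros(1) set_mset_mset)
  then obtain as bs where ys: "ys = as @ x # bs" by (meson split_list)
  then have "mset xs = mset (as @ bs)" using Cons.prems(2) by simp
  then have "contract x \<alpha> (as @ bs) = 0"
    using Cons.IH[OF is_form_contract[OF Cons.prems(1)]] Cons.prems(3) by (simp add: contract_def)
  then show ?case
    using is_form_move[OF Cons.prems(1)] by (simp add: ys contract_def)
qed simp

text \<open>Linearity is used one argument at a time: the first argument may be taken in
  \<open>B\<close>, and the induction hypothesis for the contraction handles the others.\<close>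

lemma is_form_eq_0_on_span:
  assumes "is_form k \<alpha>" "span B = UNIV" "\<And>xs. set xs \<subseteq> B \<Longrightarrow> \<alpha> xs = 0"
  shows "\<alpha> xs = 0"
  using assms(1,3)
proof (induction xs arbitrary: k \<alpha>)
  case (Cons x xs)
  have "\<alpha> (b # xs) = 0" if "b \<in> B" for b
    using Cons.IH[OF is_form_contract[OF Cons.prems(1), of b]] Cons.prems(2) that
    by (simp add: contract_def)
  then show ?case
    using linear_eq_0_on_span[OF is_form_linear_Cons[OF Cons.prems(1)], of B xs x] assms(2) by simp
qed simp

text \<open>A list of vectors from \<open>bs\<close> has the wrong length, repeats a vector, or is a
  permutation of \<open>bs\<close>; in each case \<open>\<alpha>\<close> vanishes on it.\<close>

lemma top_form_eq_0:
  assumes "is_form (length bs) \<alpha>" "distinct bs" "span (set bs) = UNIV" "\<alpha> bs = 0"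
  shows "\<alpha> = 0"
proof
  fix xs
  have "\<alpha> ys = 0" if "set ys \<subseteq> set bs" for ys
  proof (cases "length ys = length bs \<and> distinct ys")
    case True
    then have "set ys = set bs"
      using that assms(2) by (metis List.finite_set card_subset_eq distinct_card)
    then have "mset bs = mset ys"
      using True assms(2) by (simp add: set_eq_iff_mset_eq_distinct)
    then show ?thesis using is_form_perm[OF assms(1)] assms(4) by blast
  next
    case False
    then show ?thesis
      using assms(1) unfolding is_form_def distinct_conv_nth by (metis nat_neq_iff)
  qed
  then show "\<alpha> xs = 0 xs"
    using is_form_eq_0_on_span[OF assms(1,3)] by simp
qed

lemma top_form_proportional:
  assumes "is_form (length bs) \<alpha>" "is_form (length bs) \<Omega>" "distinct bs" "span (set bs) = UNIV" "\<Omega> bs \<noteq> 0"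
  shows "\<alpha> xs = \<alpha> bs / \<Omega> bs * \<Omega> xs"
proof -
  have "\<alpha> + (\<lambda>xs. (- (\<alpha> bs / \<Omega> bs)) * \<Omega> xs) = 0"
    by (rule top_form_eq_0[OF is_form_add[OF assms(1) is_form_scale[OF assms(2)]] assms(3,4)])
      (simp add: assms(5))
  from fun_cong[OF this, of xs] show ?thesis by simp
qed

section \<open>Explicit wedge products in low degree, and pairing with 1-forms\<close>

lemma wedge_0form_left: "is_form 0 \<alpha> \<Longrightarrow> (\<alpha> \<^bold>\<and> \<beta>) xs = \<alpha> [] * \<beta> xs"
  by (induction xs arbitrary: \<beta>)
    (simp_all add: wedge_Nil wedge_Cons contract_0form wedge_zero_left, simp add: contract_def)

lemma wedge_1form_right_Cons:
  assumes "is_form p \<alpha>" "is_form 1 \<eta>"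
  shows "(\<alpha> \<^bold>\<and> \<eta>) (x # xs) = (contract x \<alpha> \<^bold>\<and> \<eta>) xs + (- 1) ^ p * (\<alpha> xs * \<eta> [x])"
  using wedge_0form_right[OF assms(1), of "contract x \<eta>"] is_form_contract[OF assms(2), of x]
  by (simp add: wedge_Cons[OF assms(1)] contract_def[of x \<eta> "[]"])

lemma wedge_1form_left_Cons:
  assumes "is_form 1 \<eta>"
  shows "(\<eta> \<^bold>\<and> \<beta>) (x # xs) = \<eta> [x] * \<beta> xs - (\<eta> \<^bold>\<and> contract x \<beta>) xs"
  using wedge_0form_left[of "contract x \<eta>" \<beta> xs] is_form_contract[OF assms, of x]
  by (simp add: wedge_Cons[OF assms] contract_def[of x \<eta> "[]"])

lemma wedge_2form_1form:
  assumes "is_form 2 \<alpha>" "is_form 1 \<eta>"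
  shows "(\<alpha> \<^bold>\<and> \<eta>) [x, y, z] = \<alpha> [x, y] * \<eta> [z] - \<alpha> [x, z] * \<eta> [y] + \<alpha> [y, z] * \<eta> [x]"
proof -
  have 1: "is_form 1 (contract x \<alpha>)" for x
    using is_form_contract[OF assms(1)] by simp
  have 0: "is_form 0 (contract y (contract x \<alpha>))" for x y
    using is_form_contract[OF 1] by simp
  show ?thesis
    by (simp add: wedge_1form_right_Cons[OF assms] wedge_1form_right_Cons[OF 1 assms(2)]
        wedge_0form_left[OF 0]) (simp add: contract_def)
qed

lemma wedge_1form_2form:
  assumes "is_form 1 \<eta>" "is_form 2 \<alpha>"
  shows "(\<eta> \<^bold>\<and> \<alpha>) [x, y, z] = \<eta> [x] * \<alpha> [y, z] - \<eta> [y] * \<alpha> [x, z] + \<eta> [z] * \<alpha> [x, y]"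
  by (simp add: wedge_1form_left_Cons[OF assms(1)] wedge_Nil is_form_length[OF assms(1)])
    (simp add: contract_def)

lemma wedge_3form_1form:
  assumes "is_form 3 \<alpha>" "is_form 1 \<eta>"
  shows "(\<alpha> \<^bold>\<and> \<eta>) [w, x, y, z] =
    \<alpha> [w, x, y] * \<eta> [z] - \<alpha> [w, x, z] * \<eta> [y] + \<alpha> [w, y, z] * \<eta> [x] - \<alpha> [x, y, z] * \<eta> [w]"
proof -
  have 2: "is_form 2 (contract w \<alpha>)"
    using is_form_contract[OF assms(1)] by simp
  show ?thesis
    by (simp add: wedge_1form_right_Cons[OF assms] wedge_2form_1form[OF 2 assms(2)])
      (simp add: contract_def)
qed

lemma wedge_2form_2form:
  assumes "is_form 2 \<alpha>" "is_form 2 \<beta>"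
  shows "(\<alpha> \<^bold>\<and> \<beta>) [w, x, y, z] =
    \<alpha> [w, x] * \<beta> [y, z] - \<alpha> [w, y] * \<beta> [x, z] + \<alpha> [w, z] * \<beta> [x, y]
    + \<alpha> [x, y] * \<beta> [w, z] - \<alpha> [x, z] * \<beta> [w, y] + \<alpha> [y, z] * \<beta> [w, x]"
proof -
  have 1: "is_form 1 (contract w \<alpha>)" "is_form 1 (contract w \<beta>)"
    using is_form_contract[OF assms(1)] is_form_contract[OF assms(2)] by simp_all
  show ?thesis
    by (subst wedge_Cons[OF assms(1)], simp add: wedge_1form_2form[OF 1(1) assms(2)]
        wedge_2form_1form[OF assms(1) 1(2)]) (simp add: contract_def)
qed

lemma is_form_1I:
  assumes "linear f"
  shows "is_form 1 (\<lambda>xs. case xs of [u] \<Rightarrow> f u | _ \<Rightarrow> 0)"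
  using assms by (auto simp: is_form_def length_Suc_conv split: list.split)

text \<open>If \<open>x - y\<close> is non-zero, a functional with value 1 there is obtained by
  extension from the independent set \<open>{x - y}\<close>.\<close>

lemma eq_if_1forms_eq:
  assumes "\<And>\<eta>. is_form 1 \<eta> \<Longrightarrow> \<eta> [x] = \<eta> [y]"
  shows "x = y"
proof (rule ccontr)
  assume "x \<noteq> y"
  then have "independent {x - y}" by simp
  then obtain f :: "'a \<Rightarrow> real" where f: "linear f" "f (x - y) = 1"
    using linear_independent_extend[of "{x - y}" "\<lambda>_. 1"] by auto
  then show False
    using assms[OF is_form_1I[OF f(1)]] by (simp add: linear_diff)
qed

text \<open>Expanding along \<open>xs\<close> writes the value as a combination of the numbers
  \<open>\<eta> [x]\<close> with coefficients independent of \<open>\<eta>\<close>; the same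
  combination of the vectors is \<open>s\<close>. This supplies the candidate for
  \<open>S_endo\<close>.\<close>

lemma wedge_1form_represented:
  fixes \<alpha> :: "'v::real_vector form"
  assumes "is_form p \<alpha>"
  shows "\<exists>s. \<forall>\<eta>. is_form 1 \<eta> \<longrightarrow> (\<alpha> \<^bold>\<and> \<eta>) xs = \<eta> [s]"
  using assms
proof (induction xs arbitrary: p \<alpha>)
  case Nil
  have "(\<alpha> \<^bold>\<and> \<eta>) [] = \<eta> [0]" if "is_form 1 \<eta>" for \<eta>
    using linear_0[OF is_form_linear_Cons[OF that]] is_form_length[OF that] by (simp add: wedge_Nil)
  then show ?case by blast
next
  case (Cons x xs)
  obtain s where s: "\<And>\<eta>. is_form 1 \<eta> \<Longrightarrow> (contract x \<alpha> \<^bold>\<and> \<eta>) xs = \<eta> [s]"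
    using Cons.IH[OF is_form_contract[OF Cons.prems]] by blast
  have "(\<alpha> \<^bold>\<and> \<eta>) (x # xs) = \<eta> [s + ((- 1) ^ p * \<alpha> xs) *\<^sub>R x]" if "is_form 1 \<eta>" for \<eta>
    using linear_add[OF is_form_linear_Cons[OF that], of _ _ "[]"]
      linear_scale[OF is_form_linear_Cons[OF that], of _ _ "[]"]
    by (simp add: wedge_1form_right_Cons[OF Cons.prems that] s[OF that])
  then show ?case by blast
qed

section \<open>The endomorphism induced by a 3-form\<close>

lemma extend_to_basis_list:
  fixes vs :: "'v::real_vector list"
  assumes "dim (UNIV :: 'v set) \<noteq> 0" "distinct vs" "independent (set vs)"
  obtains ws where "distinct (vs @ ws)" "span (set (vs @ ws)) = UNIV"
    "length (vs @ ws) = dim (UNIV :: 'v set)" "independent (set (vs @ ws))"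
proof -
  obtain B where B: "set vs \<subseteq> B" "independent B" "span B = UNIV"
    by (metis real_vector.maximal_independent_subset_extend[OF subset_UNIV assms(3)] top.extremum_uniqueI)
  then have c: "card B = dim (UNIV :: 'v set)"
    using real_vector.dim_eq_card_independent[OF B(2)] real_vector.dim_span[of B] by simp
  \<comment> \<open>An infinite basis would have cardinality 0, which the non-zero dimension
    excludes.\<close>
  then have "finite (B - set vs)"
    using assms(1) by (metis card.infinite finite_Diff)
  then obtain ws where ws: "set ws = B - set vs" "distinct ws"
    using finite_distinct_list by blast
  have s: "set (vs @ ws) = B" and d: "distinct (vs @ ws)"
    using B(1) ws assms(2) by auto
  show ?thesis
    by (rule that[of ws]) (use s d B(2,3) c distinct_card[OF d] in auto)
qed

lemma obtain_basis_list:
  assumes "dim (UNIV :: 'v::real_vector set) \<noteq> 0"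
  obtains bs :: "'v::real_vector list" where "distinct bs" "span (set bs) = UNIV"
    "length bs = dim (UNIV :: 'v set)" "independent (set bs)"
proof -
  have "distinct ([] :: 'v list)" "independent (set ([] :: 'v list))"
    by (simp_all add: real_vector.independent_empty)
  from extend_to_basis_list[OF assms this] show ?thesis
    using that unfolding append_Nil by blast
qed

text \<open>The definite description in \<open>S_endo\<close> denotes: values at one basis list
  determine 6-forms, which gives existence, and 1-forms separate vectors, which gives linearity and
  uniqueness.\<close>

lemma S_endo:
  fixes \<rho> \<Omega> :: "'v::real_vector form"
  assumes \<rho>: "is_form 3 \<rho>" and "orientation6 \<Omega>"
  shows "linear (S_endo \<Omega> \<rho>)"
    and "is_form 1 \<eta> \<Longrightarrow> contract v \<rho> \<^bold>\<and> \<rho> \<^bold>\<and> \<eta> = (\<lambda>xs. \<eta> [S_endo \<Omega> \<rho> v] * \<Omega> xs)"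
proof -
  have \<Omega>: "dim (UNIV :: 'v set) = 6" "is_form 6 \<Omega>" "\<Omega> \<noteq> 0"
    using assms(2) by (auto simp: orientation6_def)
  obtain bs :: "'v list" where bs: "distinct bs" "span (set bs) = UNIV" "length bs = 6"
    using obtain_basis_list[where 'v = 'v] \<Omega>(1) by (metis zero_neq_numeral)
  have nz: "\<Omega> bs \<noteq> 0"
    using top_form_eq_0[of bs \<Omega>] bs \<Omega> by auto
  have f5: "is_form 5 (contract v \<rho> \<^bold>\<and> \<rho>)" for v
    using is_form_wedge[OF is_form_contract[OF \<rho>] \<rho>, of v] by simp
  have f6: "is_form 6 (contract v \<rho> \<^bold>\<and> \<rho> \<^bold>\<and> \<eta>)" if "is_form 1 \<eta>" for v and \<eta> :: "'v form"
    using is_form_wedge[OF f5 that, of v] by simp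
  have "\<exists>s. \<forall>\<eta>. is_form 1 \<eta> \<longrightarrow> (contract v \<rho> \<^bold>\<and> \<rho> \<^bold>\<and> \<eta>) bs = \<eta> [s] * \<Omega> bs" for v
  proof -
    obtain s where s: "\<And>\<eta>. is_form 1 \<eta> \<Longrightarrow> (contract v \<rho> \<^bold>\<and> \<rho> \<^bold>\<and> \<eta>) bs = \<eta> [s]"
      using wedge_1form_represented[OF f5] by blast
    have "(contract v \<rho> \<^bold>\<and> \<rho> \<^bold>\<and> \<eta>) bs = \<eta> [(1 / \<Omega> bs) *\<^sub>R s] * \<Omega> bs" if "is_form 1 \<eta>" for \<eta>
      using nz linear_scale[OF is_form_linear_Cons[OF that], of _ _ "[]"]
      by (simp add: s[OF that])
    then show ?thesis by blast
  qed
  then obtain S where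
    S: "\<And>v \<eta>. is_form 1 \<eta> \<Longrightarrow> (contract v \<rho> \<^bold>\<and> \<rho> \<^bold>\<and> \<eta>) bs = \<eta> [S v] * \<Omega> bs"
    by metis
  \<comment> \<open>Both sides are 6-forms, so their agreement on the single basis list
    \<open>bs\<close> suffices.\<close>
  have eq: "contract v \<rho> \<^bold>\<and> \<rho> \<^bold>\<and> \<eta> = (\<lambda>xs. \<eta> [S v] * \<Omega> xs)" if "is_form 1 \<eta>" for v \<eta>
    by (rule ext, subst top_form_proportional[of bs _ \<Omega>])
      (use bs nz \<Omega> f6[OF that] in \<open>auto simp: S[OF that]\<close>)
  have lin: "linear S"
  proof (rule linearI; rule eq_if_1forms_eq)
    fix v w and \<eta> :: "'v form" assume \<eta>: "is_form 1 \<eta>"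
    have "\<eta> [S (v + w)] * \<Omega> bs = (\<eta> [S v] + \<eta> [S w]) * \<Omega> bs"
      unfolding S[OF \<eta>, symmetric] contract_add[OF \<rho>]
      by (simp add: S[OF \<eta>, symmetric] distrib_right)
        (simp add: wedge_def[of _ \<eta>] wedge_add_left distrib_left distrib_right sum.distrib)
    then show "\<eta> [S (v + w)] = \<eta> [S v + S w]"
      using nz linear_add[OF is_form_linear_Cons[OF \<eta>]] by simp
  next
    fix c v and \<eta> :: "'v form" assume \<eta>: "is_form 1 \<eta>"
    have "\<eta> [S (c *\<^sub>R v)] * \<Omega> bs = c * (\<eta> [S v] * \<Omega> bs)"
      unfolding S[OF \<eta>, symmetric] contract_scale[OF \<rho>]
      by (simp add: wedge_def[of _ \<eta>] wedge_scale_left sum_distrib_left mult_ac)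
    then show "\<eta> [S (c *\<^sub>R v)] = \<eta> [c *\<^sub>R S v]"
      using nz linear_scale[OF is_form_linear_Cons[OF \<eta>]] by simp
  qed
  have "S_endo \<Omega> \<rho> = S"
    unfolding S_endo_def
  proof (rule the_equality)
    show "linear S \<and> (\<forall>v \<eta>. is_form 1 \<eta> \<longrightarrow> contract v \<rho> \<^bold>\<and> \<rho> \<^bold>\<and> \<eta> = (\<lambda>xs. \<eta> [S v] * \<Omega> xs))"
      using lin eq by blast
  next
    fix T
    assume T: "linear T \<and> (\<forall>v \<eta>. is_form 1 \<eta> \<longrightarrow> contract v \<rho> \<^bold>\<and> \<rho> \<^bold>\<and> \<eta> = (\<lambda>xs. \<eta> [T v] * \<Omega> xs))"
    show "T = S"
    proof (rule ext, rule eq_if_1forms_eq)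
      fix v and \<eta> :: "'v form" assume \<eta>: "is_form 1 \<eta>"
      have "\<eta> [T v] * \<Omega> bs = \<eta> [S v] * \<Omega> bs"
        using T \<eta> S[OF \<eta>, of v] by metis
      then show "\<eta> [T v] = \<eta> [S v]" using nz by simp
    qed
  qed
  then show "linear (S_endo \<Omega> \<rho>)"
    and "is_form 1 \<eta> \<Longrightarrow> contract v \<rho> \<^bold>\<and> \<rho> \<^bold>\<and> \<eta> = (\<lambda>xs. \<eta> [S_endo \<Omega> \<rho> v] * \<Omega> xs)"
    using lin eq by auto
qed

text \<open>With \<open>\<alpha> = \<iota>\<^sub>v \<rho>\<close> and \<open>\<eta> = \<iota>\<^sub>y \<alpha>\<close>, contracting the 6-form \<open>\<alpha> \<and> \<rho> \<and> \<eta>\<close> with \<open>v\<close> and then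
  with \<open>y\<close> leaves \<open>2 \<alpha> \<and> \<eta> \<and> \<eta> = 0\<close>; hence \<open>\<eta>(S v) = 0\<close>.\<close>

lemma contract_S_endo:
  fixes \<rho> \<Omega> :: "'v::real_vector form"
  assumes \<rho>: "is_form 3 \<rho>" and "orientation6 \<Omega>"
  shows "\<rho> [v, S_endo \<Omega> \<rho> v, y] = 0"
proof -
  have \<Omega>: "dim (UNIV :: 'v set) = 6" "is_form 6 \<Omega>" "\<Omega> \<noteq> 0"
    using assms(2) by (auto simp: orientation6_def)
  define \<alpha> where "\<alpha> = contract v \<rho>"
  define \<eta> where "\<eta> = contract y \<alpha>"
  have \<alpha>: "is_form 2 \<alpha>" using is_form_contract[OF \<rho>, of v] by (simp add: \<alpha>_def)
  have \<eta>: "is_form 1 \<eta>" using is_form_contract[OF \<alpha>, of y] by (simp add: \<eta>_def)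
  \<comment> \<open>For independent \<open>v\<close> and \<open>y\<close> there is a basis list
    starting with them, on which \<open>\<Omega>\<close> does not vanish. The dependent cases follow
    from linearity and alternation.\<close>
  consider "v = 0" | c where "y = c *\<^sub>R v" | "v \<noteq> y" "independent {v, y}"
  proof (cases "y \<in> span {v}")
    case True
    then show ?thesis using that(2) by (auto simp: real_vector.span_singleton)
  next
    case False
    then have "v \<noteq> y" using real_vector.span_base[of y "{v}"] by auto
    moreover have "independent {y, v}" if "v \<noteq> 0"
      using False that \<open>v \<noteq> y\<close> by (subst real_vector.independent_insert) auto
    ultimately show ?thesis using that(1,3) by (auto simp: insert_commute)
  qed
  then show ?thesis
  proof cases
    case 1
    then show ?thesis using linear_0[OF is_form_linear_Cons[OF \<rho>]] by simp
  next
    case 2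
    have "linear (\<lambda>x. contract (S_endo \<Omega> \<rho> v) \<alpha> [x])"
      using is_form_linear_Cons is_form_contract[OF \<alpha>] by blast
    then show ?thesis
      using is_form_repeat[OF \<rho>, of v "[S_endo \<Omega> \<rho> v]" "[]"] linear_scale[of _ c v] 2
      by (fastforce simp: contract_def \<alpha>_def)
  next
    case 3
    then have "distinct [v, y]" "independent (set [v, y])" by simp_all
    then obtain es where "distinct ([v, y] @ es)" "span (set ([v, y] @ es)) = UNIV" "length ([v, y] @ es) = 6"
      using extend_to_basis_list[of "[v, y]"] \<Omega>(1) by (metis zero_neq_numeral)
    then have es: "distinct (v # y # es)" "span (set (v # y # es)) = UNIV" "length (v # y # es) = 6"
      by simp_all
    then have nz: "\<Omega> (v # y # es) \<noteq> 0"
      using top_form_eq_0[of "v # y # es" \<Omega>] \<Omega> by auto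
    have v\<alpha>: "contract v \<alpha> = 0"
      using contract_contract[OF \<rho>] by (simp add: \<alpha>_def)
    have v\<eta>: "contract v \<eta> = 0"
      using is_form_repeat[OF \<rho>, of v "[y]"] by (auto simp: \<eta>_def \<alpha>_def contract_def)
    have y\<eta>: "contract y \<eta> = 0"
      using contract_contract[OF \<alpha>] by (simp add: \<eta>_def)
    have f5: "is_form 5 (\<alpha> \<^bold>\<and> \<rho>)" and f4: "is_form 4 (\<alpha> \<^bold>\<and> \<alpha>)" and f3: "is_form 3 (\<alpha> \<^bold>\<and> \<eta>)"
      using is_form_wedge[OF \<alpha> \<rho>] is_form_wedge[OF \<alpha> \<alpha>] is_form_wedge[OF \<alpha> \<eta>] by simp_all
    have v: "contract v (\<alpha> \<^bold>\<and> \<rho>) = \<alpha> \<^bold>\<and> \<alpha>"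
      by (simp add: contract_wedge[OF \<alpha>] v\<alpha> wedge_zero_left flip: \<alpha>_def)
    \<comment> \<open>The factors commute because \<open>\<alpha>\<close> has even degree; this is
      read off from the explicit formulas on three vectors.\<close>
    have comm: "(\<eta> \<^bold>\<and> \<alpha>) xs = (\<alpha> \<^bold>\<and> \<eta>) xs" for xs
    proof (cases "length xs = 3")
      case True
      then obtain a b c where "xs = [a, b, c]"
        by (auto simp: numeral_3_eq_3 length_Suc_conv)
      then show ?thesis
        by (simp add: wedge_1form_2form[OF \<eta> \<alpha>] wedge_2form_1form[OF \<alpha> \<eta>])
    next
      case False
      then show ?thesis
        using is_form_length[OF f3] is_form_length[OF is_form_wedge[OF \<eta> \<alpha>]] by simp
    qed
    have y: "contract y (\<alpha> \<^bold>\<and> \<alpha>) = (\<lambda>xs. 2 * (\<alpha> \<^bold>\<and> \<eta>) xs)"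
      by (rule ext) (simp add: contract_wedge[OF \<alpha>] comm flip: \<eta>_def)
    obtain a b c d where abcd: "es = [a, b, c, d]"
      using es(3) by (auto simp: eval_nat_numeral length_Suc_conv)
    have "\<eta> [S_endo \<Omega> \<rho> v] * \<Omega> (v # y # es) = (\<alpha> \<^bold>\<and> \<rho> \<^bold>\<and> \<eta>) (v # y # es)"
      using S_endo(2)[OF assms \<eta>, of v] by (simp add: \<alpha>_def)
    also have "\<dots> = (\<alpha> \<^bold>\<and> \<alpha> \<^bold>\<and> \<eta>) (y # es)"
      by (simp add: wedge_Cons[OF f5] v v\<eta> wedge_zero_right)
    also have "\<dots> = 2 * (\<alpha> \<^bold>\<and> \<eta> \<^bold>\<and> \<eta>) es"
      by (simp add: wedge_Cons[OF f4] y y\<eta> wedge_zero_right wedge_scale_left)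
    \<comment> \<open>The square of the 1-form \<open>\<eta>\<close> is zero, seen here by expanding
      on the four remaining basis vectors.\<close>
    also have "\<dots> = 0"
      unfolding abcd by (simp add: wedge_3form_1form[OF f3 \<eta>] wedge_2form_1form[OF \<alpha> \<eta>] algebra_simps)
    finally have "\<eta> [S_endo \<Omega> \<rho> v] = 0" using nz by simp
    \<comment> \<open>The number \<open>\<eta> [S_endo \<Omega> \<rho> v]\<close> is
      \<open>\<rho>\<close> with \<open>y\<close> in the second place, one transposition away from
      the claim.\<close>
    then show ?thesis
      using is_form_swap[OF is_form_contract[OF \<rho>, of v], of y _ "[]"]
      by (simp add: \<eta>_def \<alpha>_def contract_def)
  qed
qed

section \<open>The central extension\<close>

text \<open>Each summand replaces two vectors by their bracket, so \<open>\<alpha>\<close> receives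
  a list shorter by one. Identities between differentials thus need checking only on lists of length
  \<open>Suc k\<close>.\<close>

lemma ce_diff_eq_0_if_length:
  assumes "is_form k \<alpha>" "length xs \<noteq> Suc k"
  shows "ce_diff br \<alpha> xs = 0"
  unfolding ce_diff_def
proof (intro sum.neutral ballI)
  fix j i assume ij: "j \<in> {..<length xs}" "i \<in> {..<j}"
  have "{m. m < length xs \<and> m \<in> - {i, j}} = {..<length xs} - {i, j}" by auto
  then have "length (nths xs (- {i, j})) = length xs - 2"
    using ij by (simp add: length_nths card_Diff_subset)
  then have "length (br (xs ! i) (xs ! j) # nths xs (- {i, j})) \<noteq> k"
    using ij assms(2) by auto
  then show "(- 1) ^ (i + j) * \<alpha> (br (xs ! i) (xs ! j) # nths xs (- {i, j})) = 0"
    using is_form_length[OF assms(1)] by simp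
qed

lemma ce_diff_3:
  "ce_diff br \<alpha> [x, y, z] = - \<alpha> [br x y, z] + \<alpha> [br x z, y] - \<alpha> [br y z, x]"
  by (simp add: ce_diff_def nths_Cons numeral_eq_Suc)

lemma ce_diff_4:
  "ce_diff br \<alpha> [w, x, y, z] =
    - \<alpha> [br w x, y, z] + \<alpha> [br w y, x, z] - \<alpha> [br w z, x, y]
    - \<alpha> [br x y, w, z] + \<alpha> [br x z, w, y] - \<alpha> [br y z, w, x]"
  by (simp add: ce_diff_def nths_Cons numeral_eq_Suc)

lemma linear_Cons_Cons:
  assumes "is_form k \<alpha>"
  shows "linear (\<lambda>x. \<alpha> (y # x # xs))"
  using is_form_linear_Cons[OF is_form_contract[OF assms, of y]] by (simp add: contract_def)

text \<open>In the first component the Jacobi identity is that of \<open>br\<close>. In the second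
  it is the cyclic sum \<open>J\<close> up to sign, and that sum equals the differential of
  \<open>\<omega>\<^sub>0\<close> at \<open>x\<close>, \<open>y\<close>, \<open>z\<close>.\<close>

lemma lie_algebra_central_ext:
  assumes "lie_algebra br" "is_form 2 \<omega>\<^sub>0" "ce_diff br \<omega>\<^sub>0 = 0"
  shows "lie_algebra (central_ext br \<omega>\<^sub>0)"
proof -
  have br: "bilinear br" "br x x = 0" "br x (br y z) + br y (br z x) + br z (br x y) = 0" for x y z
    using assms(1) by (auto simp: lie_algebra_def)
  note L = is_form_linear_Cons[OF assms(2)] linear_Cons_Cons[OF assms(2)]
  have swap: "\<omega>\<^sub>0 [x, y] = - \<omega>\<^sub>0 [y, x]" for x y
    by (rule is_form_swap[OF assms(2)])
  have zx: "br x z = - br z x" for x z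
    using br(2)[of "x + z"] br(2)[of x] br(2)[of z]
    by (simp add: bilinear_ladd[OF br(1)] bilinear_radd[OF br(1)] eq_neg_iff_add_eq_0 add.commute)
  have J: "\<omega>\<^sub>0 [x, br y z] + \<omega>\<^sub>0 [y, br z x] + \<omega>\<^sub>0 [z, br x y] = 0" for x y z
    using fun_cong[OF assms(3), of "[x, y, z]"] linear_neg[OF L(1), of "br z x" "[y]"]
    by (simp add: ce_diff_3 zx[of x z] swap[of x] swap[of y] swap[of z])
  have "bilinear (central_ext br \<omega>\<^sub>0)"
    unfolding bilinear_def
    by (intro conjI allI linearI)
      (simp_all add: central_ext_def bilinear_ladd[OF br(1)] bilinear_radd[OF br(1)]
        bilinear_lmul[OF br(1)] bilinear_rmul[OF br(1)] linear_add[OF L(1)] linear_add[OF L(2)]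
        linear_scale[OF L(1)] linear_scale[OF L(2)])
  moreover have "central_ext br \<omega>\<^sub>0 x x = 0" for x
    using is_form_repeat[OF assms(2), of "fst x" "[]" "[]"] by (simp add: central_ext_def br(2) zero_prod_def)
  moreover have "central_ext br \<omega>\<^sub>0 x (central_ext br \<omega>\<^sub>0 y z) +
      central_ext br \<omega>\<^sub>0 y (central_ext br \<omega>\<^sub>0 z x) + central_ext br \<omega>\<^sub>0 z (central_ext br \<omega>\<^sub>0 x y) = 0" for x y z
    using J[of "fst x" "fst y" "fst z"] by (simp add: central_ext_def br(3) zero_prod_def)
  ultimately show ?thesis
    by (simp add: lie_algebra_def)
qed

text \<open>A basis of the first factor together with \<open>(0, 1)\<close> is a basis of the
  product. The non-zero dimension ensures that the first basis is finite.\<close>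

lemma dim_prod_real:
  assumes "dim (UNIV :: 'v::real_vector set) \<noteq> 0"
  shows "dim (UNIV :: ('v \<times> real) set) = Suc (dim (UNIV :: 'v set))"
proof -
  obtain bs :: "'v list" where bs: "distinct bs" "span (set bs) = UNIV" "length bs = dim (UNIV :: 'v set)"
    "independent (set bs)"
    using obtain_basis_list[OF assms] by blast
  define B where "B = set bs"
  have B: "finite B" "span B = UNIV" "card B = dim (UNIV :: 'v set)"
    using bs distinct_card[of bs] by (auto simp: B_def)
  have "independent B" using bs(4) by (simp add: B_def)
  define E :: "('v \<times> real) set" where "E = (\<lambda>b. (b, 0)) ` B"
  have lin: "linear (\<lambda>b::'v. (b, 0::real))" by (rule linearI) auto
  have spE: "span E = (\<lambda>b. (b, 0)) ` UNIV"
    unfolding E_def using linear_span_image[OF lin, of B] B(2) by simp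
  have "independent E"
    unfolding E_def by (rule linear_independent_injective_image[OF lin \<open>independent B\<close>]) (auto simp: inj_on_def)
  moreover have nin: "(0, 1) \<notin> span E" unfolding spE by auto
  ultimately have ind: "independent (insert (0, 1) E)"
    by (simp add: real_vector.independent_insertI)
  have "(x, t) \<in> span (insert (0, 1) E)" for x t
  proof -
    have "(x, 0) \<in> span (insert (0, 1) E)"
      using spE real_vector.span_mono[of E "insert (0, 1) E"] by auto
    moreover have "t *\<^sub>R (0, 1) \<in> span (insert (0, 1) E)"
      by (intro real_vector.span_scale real_vector.span_base) simp
    ultimately have "(x, 0) + t *\<^sub>R (0, 1) \<in> span (insert (0, 1) E)"
      by (rule real_vector.span_add)
    then show ?thesis by simp
  qed
  then have "span (insert (0, 1) E) = UNIV" by auto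
  then have "dim (UNIV :: ('v \<times> real) set) = card (insert (0, 1) E)"
    using real_vector.dim_eq_card_independent[OF ind] real_vector.dim_span by metis
  also have "\<dots> = Suc (card E)"
    using nin real_vector.span_base B(1) by (subst card_insert_disjoint) (auto simp: E_def)
  also have "card E = card B"
    unfolding E_def by (rule card_image) (auto simp: inj_on_def)
  finally show ?thesis by (simp add: B(3))
qed

text \<open>\<open>extend_form\<close> is the pullback along the linear map
  \<open>fst\<close>.\<close>

lemma is_form_extend:
  assumes "is_form k \<alpha>"
  shows "is_form k (extend_form \<alpha>)"
proof -
  have "linear (\<lambda>x. extend_form \<alpha> (xs[i := x]))" if "length xs = k" "i < k" for xs i
  proof -
    have "linear (\<lambda>x. \<alpha> ((map fst xs)[i := x]))"
      using assms that unfolding is_form_def by simp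
    from linear_compose[OF linear_fst this] show ?thesis
      by (simp add: extend_form_def map_update o_def)
  qed
  moreover have "extend_form \<alpha> xs = 0"
    if "length xs = k" "i < j" "j < k" "xs ! i = xs ! j" for xs :: "('a \<times> real) list" and i j
  proof -
    have "length (map fst xs) = k \<and> i < j \<and> j < k \<and> map fst xs ! i = map fst xs ! j"
      using that by simp
    then show ?thesis
      using assms unfolding is_form_def extend_form_def by blast
  qed
  ultimately show ?thesis
    using is_form_length[OF assms] by (auto simp: is_form_def extend_form_def)
qed

lemma is_form_theta: "is_form 1 theta"
  using is_form_1I[OF linear_snd] by (simp add: theta_def[abs_def])

lemma G2_form_eval:
  assumes "is_form 2 \<omega>"
  shows "(extend_form \<omega> \<^bold>\<and> theta + extend_form \<rho>) [(x, a), (y, b), (z, c)] =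
    \<omega> [x, y] * c - \<omega> [x, z] * b + \<omega> [y, z] * a + \<rho> [x, y, z]"
  by (simp add: wedge_2form_1form[OF is_form_extend[OF assms] is_form_theta])
    (simp add: extend_form_def theta_def)

lemma is_form_G2_form:
  assumes "is_form 2 \<omega>" "is_form 3 \<rho>"
  shows "is_form 3 (extend_form \<omega> \<^bold>\<and> theta + extend_form \<rho>)"
  using is_form_add[OF is_form_wedge[OF is_form_extend[OF assms(1)] is_form_theta]]
    is_form_extend[OF assms(2)] by simp

text \<open>Evaluated on four vectors, the coefficients of \<open>a\<close>, \<open>b\<close>,
  \<open>c\<close>, \<open>d\<close> are values of the differential of \<open>\<omega>\<close>. The
  second components of the brackets produce the wedge product of \<open>\<omega>\<close> and
  \<open>\<omega>\<^sub>0\<close>, which cancels the differential of \<open>\<rho>\<close>.\<close>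

lemma ce_diff_G2_form:
  assumes "is_form 2 \<omega>" "is_form 3 \<rho>" "is_form 2 \<omega>\<^sub>0"
    and d\<omega>: "ce_diff br \<omega> = 0" and d\<rho>: "ce_diff br \<rho> = - (\<omega> \<^bold>\<and> \<omega>\<^sub>0)"
  shows "ce_diff (central_ext br \<omega>\<^sub>0) (extend_form \<omega> \<^bold>\<and> theta + extend_form \<rho>) = 0"
proof
  fix us
  show "ce_diff (central_ext br \<omega>\<^sub>0) (extend_form \<omega> \<^bold>\<and> theta + extend_form \<rho>) us = 0 us"
  proof (cases "length us = 4")
    case False
    then show ?thesis
      using ce_diff_eq_0_if_length[OF is_form_G2_form[OF assms(1,2)]] by simp
  next
    case True
    then obtain w a x b y c z d where us: "us = [(w, a), (x, b), (y, c), (z, d)]"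
      by (auto simp: eval_nat_numeral length_Suc_conv)
    have 1: "\<omega> [br p q, r] = \<omega> [br p r, q] - \<omega> [br q r, p]" for p q r
      using fun_cong[OF d\<omega>, of "[p, q, r]"] by (simp add: ce_diff_3)
    have 2: "- \<rho> [br w x, y, z] + \<rho> [br w y, x, z] - \<rho> [br w z, x, y]
        - \<rho> [br x y, w, z] + \<rho> [br x z, w, y] - \<rho> [br y z, w, x] =
      - (\<omega> [w, x] * \<omega>\<^sub>0 [y, z] - \<omega> [w, y] * \<omega>\<^sub>0 [x, z] + \<omega> [w, z] * \<omega>\<^sub>0 [x, y]
        + \<omega> [x, y] * \<omega>\<^sub>0 [w, z] - \<omega> [x, z] * \<omega>\<^sub>0 [w, y] + \<omega> [y, z] * \<omega>\<^sub>0 [w, x])"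
      using fun_cong[OF d\<rho>, of "[w, x, y, z]"]
      by (simp add: ce_diff_4 wedge_2form_2form[OF assms(1,3)])
    show ?thesis
      unfolding us ce_diff_4 central_ext_def fst_conv snd_conv G2_form_eval[OF assms(1)]
      using 2 unfolding 1[of w x y] 1[of w x z] 1[of w y z] 1[of x y z]
      by (simp add: algebra_simps)
  qed
qed

section \<open>Kernels of the contracted 3-forms\<close>

lemma definite6_kernel:
  fixes \<rho> \<omega> \<Omega> :: "'v::real_vector form"
  assumes \<rho>: "definite6 \<rho>" and \<Omega>: "orientation6 \<Omega>" and tame: "taming (J_endo \<Omega> \<rho>) \<omega>"
    and v: "v \<noteq> 0"
  shows "\<rho> [v, J_endo \<Omega> \<rho> v, y] = 0"
    and "(\<And>y. \<rho> [v, x, y] = 0) \<Longrightarrow> \<exists>p q. x = p *\<^sub>R v + q *\<^sub>R J_endo \<Omega> \<rho> v"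
proof -
  have \<rho>3: "is_form 3 \<rho>" and \<omega>: "is_form 2 \<omega>"
    using \<rho> tame by (auto simp: definite6_def taming_def)
  define J where "J = J_endo \<Omega> \<rho> v"
  define K where "K = {x. \<forall>y. contract v \<rho> [x, y] = 0}"
  have ctr: "\<rho> [v, J, y] = 0" for y
    using linear_scale[OF linear_Cons_Cons[OF \<rho>3]] contract_S_endo[OF \<rho>3 \<Omega>]
    by (simp add: J_def J_endo_def)
  then show "\<rho> [v, J_endo \<Omega> \<rho> v, y] = 0" by (simp add: J_def)
  assume x: "\<And>y. \<rho> [v, x, y] = 0"
  have "form_rank (contract v \<rho>) = 4" "dim (UNIV :: 'v set) = 6"
    using \<rho> v by (auto simp: definite6_def)
  then have dimK: "dim K = 2" by (simp add: form_rank_def K_def)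
  then obtain B where B: "K \<subseteq> span B" "card B = 2"
    using real_vector.basis_exists[of K] by metis
  then have "finite B" using card.infinite by fastforce
  have pos: "\<omega> [v, J] > 0" using tame v by (simp add: taming_def J_def)
  \<comment> \<open>On a multiple of \<open>v\<close> the form \<open>\<omega> [v, _]\<close>
    vanishes, whereas taming makes it positive at \<open>J\<close>.\<close>
  have "J \<notin> span {v}"
  proof
    assume "J \<in> span {v}"
    then obtain c where "J = c *\<^sub>R v" by (auto simp: real_vector.span_singleton)
    then have "\<omega> [v, J] = c * \<omega> [v, v]"
      using linear_scale[OF linear_Cons_Cons[OF \<omega>]] by simp
    then show False
      using pos is_form_repeat[OF \<omega>, of v "[]" "[]"] by simp
  qed
  then have ind: "independent {J, v}" and ne: "J \<noteq> v"
    using v real_vector.span_base[of v "{v}"] by (auto simp: real_vector.independent_insert)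
  \<comment> \<open>Otherwise \<open>x\<close>, \<open>J\<close>, \<open>v\<close> would be three
    independent vectors in the kernel \<open>K\<close>, whose dimension is
    \<open>6 - 4 = 2\<close>.\<close>
  have "x \<in> span {J, v}"
  proof (rule ccontr)
    assume nx: "x \<notin> span {J, v}"
    then have "x \<notin> {J, v}" using real_vector.span_base by blast
    moreover have "independent {x, J, v}"
      by (rule real_vector.independent_insertI[OF nx ind])
    moreover have "{x, J, v} \<subseteq> span B"
      using B(1) x ctr is_form_repeat[OF \<rho>3, of v "[]"] by (auto simp: K_def contract_def)
    ultimately have "card {x, J, v} \<le> 2"
      using real_vector.independent_span_bound[OF \<open>finite B\<close>] B(2) by metis
    then show False using \<open>x \<notin> {J, v}\<close> ne by simp
  qed
  then obtain q where "x - q *\<^sub>R J \<in> span {v}"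
    by (auto simp: real_vector.span_breakdown_eq)
  then obtain p where "x - q *\<^sub>R J = p *\<^sub>R v"
    by (auto simp: real_vector.span_singleton)
  then have "x = p *\<^sub>R v + q *\<^sub>R J" by (simp add: algebra_simps)
  then show "\<exists>p q. x = p *\<^sub>R v + q *\<^sub>R J_endo \<Omega> \<rho> v" unfolding J_def by blast
qed

text \<open>Supplies the rank \<open>7 - 1 = 6\<close> demanded by \<open>definite7\<close>.\<close>

lemma G2_form_kernel:
  fixes \<rho> \<omega> \<Omega> :: "'v::real_vector form"
  assumes \<rho>: "definite6 \<rho>" and \<Omega>: "orientation6 \<Omega>" and tame: "taming (J_endo \<Omega> \<rho>) \<omega>"
    and nondeg: "\<And>x. (\<And>y. \<omega> [x, y] = 0) \<Longrightarrow> x = 0"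
    and w: "w \<noteq> 0"
    and u: "\<And>u'. (extend_form \<omega> \<^bold>\<and> theta + extend_form \<rho>) [w, u, u'] = 0"
  shows "\<exists>s. u = s *\<^sub>R w"
proof -
  define J where "J = J_endo \<Omega> \<rho>"
  have \<rho>3: "is_form 3 \<rho>" and \<omega>: "is_form 2 \<omega>" and pos: "v \<noteq> 0 \<Longrightarrow> \<omega> [v, J v] > 0" for v
    using \<rho> tame by (auto simp: definite6_def taming_def J_def)
  have \<omega>0: "\<omega> [v, v] = 0" for v using is_form_repeat[OF \<omega>, of v "[]" "[]"] by simp
  have \<rho>0: "\<rho> [v, v, y] = 0" for v y using is_form_repeat[OF \<rho>3, of v "[]" "[y]"] by simp
  note \<omega>L = is_form_linear_Cons[OF \<omega>] linear_Cons_Cons[OF \<omega>]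
  note \<rho>L = linear_Cons_Cons[OF \<rho>3]
  obtain v a where wva: "w = (v, a)" by fastforce
  obtain x b where uxb: "u = (x, b)" by fastforce
  have E: "\<omega> [v, x] * c - \<omega> [v, y] * b + \<omega> [x, y] * a + \<rho> [v, x, y] = 0" for y c
    using u[of "(y, c)"] unfolding wva uxb G2_form_eval[OF \<omega>] .
  \<comment> \<open>Only the first term depends on \<open>c\<close>; comparing \<open>c = 1\<close>
    with \<open>c = 0\<close> at \<open>y = 0\<close> isolates it.\<close>
  have vx: "\<omega> [v, x] = 0" using E[of 1 0] E[of 0 0] by simp
  then have E: "\<rho> [v, x, y] = \<omega> [v, y] * b - \<omega> [x, y] * a" for y
    using E[of 0 y] by simp
  show ?thesis
  proof (cases "v = 0")
    \<comment> \<open>Here \<open>w\<close> is a non-zero multiple of the central vector, and the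
      contraction reduces to \<open>a\<close> times \<open>\<omega>\<close>; non-degeneracy gives
      \<open>x = 0\<close>.\<close>
    case True
    then have "a \<noteq> 0" using w by (simp add: wva zero_prod_def)
    have "\<omega> [0, y] = 0" "\<rho> [0, x, y] = 0" for y
      using linear_0[OF \<omega>L(1)] linear_0[OF is_form_linear_Cons[OF \<rho>3]] by auto
    then have "\<omega> [x, y] = 0" for y
      using E[of y] True \<open>a \<noteq> 0\<close> by simp
    then have "x = 0" by (rule nondeg)
    then show ?thesis
      using \<open>a \<noteq> 0\<close> True by (intro exI[of _ "b / a"]) (simp add: wva uxb)
  next
    case v: False
    note ker = definite6_kernel[OF \<rho> \<Omega> tame, folded J_def]
    show ?thesis
    proof (cases "a = 0")
      case True
      have "\<rho> [v, x, J v] = 0"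
        using ker(1)[OF v, of x] is_form_swap[OF is_form_contract[OF \<rho>3, of v], of x "J v" "[]"]
        by (simp add: contract_def)
      then have "b = 0" using E[of "J v"] True pos[OF v] by simp
      then obtain p q where x: "x = p *\<^sub>R v + q *\<^sub>R J v"
        using ker(2)[OF v, of x] E True by auto
      have "q * \<omega> [v, J v] = 0"
        using vx by (simp add: x linear_add[OF \<omega>L(2)] linear_scale[OF \<omega>L(2)] \<omega>0)
      then have "q = 0" using pos[OF v] by simp
      then show ?thesis
        using True \<open>b = 0\<close> by (intro exI[of _ p]) (simp add: wva uxb x)
    next
      case a: False
      \<comment> \<open>This is the first component of \<open>u - (b / a) *\<^sub>R w\<close>, whose
        second component is zero.\<close>
      define x' where "x' = x - (b / a) *\<^sub>R v"
      have E': "\<rho> [v, x', y] = - a * \<omega> [x', y]" for y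
        using a by (simp add: x'_def linear_diff[OF \<rho>L] linear_scale[OF \<rho>L] \<rho>0 E
            linear_diff[OF \<omega>L(1)] linear_scale[OF \<omega>L(1)] field_simps)
      have "x' = 0"
      proof (rule ccontr)
        assume "x' \<noteq> 0"
        \<comment> \<open>A cyclic rotation brings \<open>x'\<close> and \<open>J x'\<close> to the
          front, so that the kernel statement can be used at \<open>x'\<close> instead of
          \<open>v\<close>.\<close>
        have "\<rho> [v, x', J x'] = - \<rho> [x', v, J x']"
          by (rule is_form_swap[OF \<rho>3])
        also have "\<dots> = \<rho> [x', J x', v]"
          using is_form_swap[OF is_form_contract[OF \<rho>3, of x'], of v "J x'" "[]"]
          by (simp add: contract_def)
        also have "\<dots> = 0" by (rule ker(1)[OF \<open>x' \<noteq> 0\<close>])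
        finally show False
          using E'[of "J x'"] a pos[OF \<open>x' \<noteq> 0\<close>] by simp
      qed
      then show ?thesis
        using a by (intro exI[of _ "b / a"]) (simp add: wva uxb x'_def)
    qed
  qed
qed

theorem proposition3p1:
  fixes br :: "'h::real_vector \<Rightarrow> 'h \<Rightarrow> 'h"
    and \<omega>\<^sub>0 \<omega> \<rho> \<Omega> :: "'h form"
  assumes "lie_algebra br" and "dim (UNIV :: 'h set) = 6"
    and "is_form 2 \<omega>\<^sub>0" and "ce_diff br \<omega>\<^sub>0 = 0"
    and "definite6 \<rho>" and "symplectic br \<omega>"
    and "orientation6 \<Omega>" and "taming (J_endo \<Omega> \<rho>) \<omega>"
    and "ce_diff br \<rho> = - (\<omega> \<^bold>\<and> \<omega>\<^sub>0)"
  shows "lie_algebra (central_ext br \<omega>\<^sub>0) \<and> dim (UNIV :: ('h \<times> real) set) = 7 \<and>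
    closed_G2_structure (central_ext br \<omega>\<^sub>0) (extend_form \<omega> \<^bold>\<and> theta + extend_form \<rho>)"
proof -
  let ?\<phi> = "extend_form \<omega> \<^bold>\<and> theta + extend_form \<rho>"
  have \<omega>: "is_form 2 \<omega>" "ce_diff br \<omega> = 0" "\<And>x. (\<And>y. \<omega> [x, y] = 0) \<Longrightarrow> x = 0"
    using assms(6) by (auto simp: symplectic_def)
  have \<rho>: "is_form 3 \<rho>" using assms(5) by (simp add: definite6_def)
  have \<phi>: "is_form 3 ?\<phi>" by (rule is_form_G2_form[OF \<omega>(1) \<rho>])
  have dim: "dim (UNIV :: ('h \<times> real) set) = 7"
    using dim_prod_real[where 'v = 'h] assms(2) by simp
  have "form_rank (contract w ?\<phi>) = 6" if w: "w \<noteq> 0" for w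
  proof -
    \<comment> \<open>One inclusion is \<open>G2_form_kernel\<close>; the other is
      alternation.\<close>
    have "{u. \<forall>u'. contract w ?\<phi> [u, u'] = 0} = span {w}"
    proof (intro subset_antisym subsetI)
      fix u assume "u \<in> {u. \<forall>u'. contract w ?\<phi> [u, u'] = 0}"
      then have "\<exists>s. u = s *\<^sub>R w"
        by (intro G2_form_kernel[OF assms(5,7,8) \<omega>(3) w]) (auto simp: contract_def)
      then show "u \<in> span {w}" by (auto simp: real_vector.span_singleton)
    next
      fix u assume "u \<in> span {w}"
      then obtain s where "u = s *\<^sub>R w" by (auto simp: real_vector.span_singleton)
      then have "?\<phi> [w, u, u'] = 0" for u'
        using linear_scale[OF linear_Cons_Cons[OF \<phi>]] is_form_repeat[OF \<phi>, of w "[]"] by simp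
      then show "u \<in> {u. \<forall>u'. contract w ?\<phi> [u, u'] = 0}" by (simp add: contract_def)
    qed
    moreover have "dim (span {w}) = 1"
      using real_vector.dim_eq_card_independent[of "{w}"] w by (simp add: real_vector.dim_span)
    ultimately show ?thesis by (simp add: form_rank_def dim)
  qed
  then show ?thesis
    using lie_algebra_central_ext[OF assms(1,3,4)] dim \<phi> ce_diff_G2_form[OF \<omega>(1) \<rho> assms(3) \<omega>(2) assms(9)]
    by (simp add: closed_G2_structure_def definite7_def)
qed

end
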